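(* The $p\times 2\times 2$ planar transportation polytopes are in one-to-one correspondence with the $p\times 2$ classical transportation polytopes, with corresponding pairs being linearly isomorphic. That is, every $p\times 2\times 2$ planar transportation polytope is linearly isomorphic to some $p\times 2$ classical transportation polytope, and every $p\times 2$ classical transportation polytope is linearly isomorphic to some $p\times 2\times 2$ planar transportation polytope.
   Context: For $u\in\mathbb{R}^p$, $v\in\mathbb{R}^q$, the $p\times q$ classical transportation polytope with marginals $u,v$ is $\{x\in\mathbb{R}_{\ge0}^{p\times q}: \sum_j x_{i,j}=u_i\ \forall i,\ \sum_i x_{i,j}=v_j\ \forall j\}$. A $p\times q\times s$ planar transportation polytope (3-way transportation polytope defined by 2-marginals) is given by real matrices $U$ of size $q\times s$, $V$ of size $p\times s$, $W$ of size $p\times q$, and is the set of $x=(x_{i,j,k})\in\mathbb{R}_{\ge0}^{p\times q\times s}$ with $\sum_i x_{i,j,k}=U_{j,k}$ for all $j,k$, $\sum_j x_{i,j,k}=V_{i,k}$ for all $i,k$, and $\sum_k x_{i,j,k}=W_{i,j}$ for all $i,j$. *)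

theory Defs
  imports "HOL-Analysis.Analysis"
begin

text \<open>
  The sizes \<open>p, q, s\<close> are the cardinalities of finite index types \<open>'p, 'q, 's\<close>. An array indexed by
  \<open>p \<times> q \<times> s\<close> has type \<^typ>\<open>real ^ 's ^ 'q ^ 'p\<close>, so that its \<open>(i, j, k)\<close> entry is
  \<open>x $ i $ j $ k\<close>. As in the usual definition, the marginals are arbitrary, so
  the polytopes may be empty.
\<close>

definition classical_transportation_polytope ::
    "real ^ 'p \<Rightarrow> real ^ 'q \<Rightarrow> (real ^ 'q ^ 'p) set" where
  "classical_transportation_polytope u v =
     {x. (\<forall>i j. 0 \<le> x $ i $ j) \<and>
         (\<forall>i. (\<Sum>j\<in>UNIV. x $ i $ j) = u $ i) \<and>
         (\<forall>j. (\<Sum>i\<in>UNIV. x $ i $ j) = v $ j)}"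

definition planar_transportation_polytope ::
    "real ^ 's ^ 'q \<Rightarrow> real ^ 's ^ 'p \<Rightarrow> real ^ 'q ^ 'p \<Rightarrow> (real ^ 's ^ 'q ^ 'p) set" where
  "planar_transportation_polytope U V W =
     {x. (\<forall>i j k. 0 \<le> x $ i $ j $ k) \<and>
         (\<forall>j k. (\<Sum>i\<in>UNIV. x $ i $ j $ k) = U $ j $ k) \<and>
         (\<forall>i k. (\<Sum>j\<in>UNIV. x $ i $ j $ k) = V $ i $ k) \<and>
         (\<forall>i j. (\<Sum>k\<in>UNIV. x $ i $ j $ k) = W $ i $ j)}"

definition classical_transportation_polytopes :: "(real ^ 'q ^ 'p) set set" where
  "classical_transportation_polytopes = {classical_transportation_polytope u v | u v. True}"

definition planar_transportation_polytopes :: "(real ^ 's ^ 'q ^ 'p) set set" where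
  "planar_transportation_polytopes = {planar_transportation_polytope U V W | U V W. True}"

text \<open>
  Both directions are required to be linear: a linear map that is merely bijective from \<open>P\<close> to \<open>Q\<close>
  need not have a linear inverse (it can send a single nonzero point to the origin). By linearity
  the maps are mutually inverse on the linear spans of \<open>P\<close> and \<open>Q\<close>, not only on \<open>P\<close> and \<open>Q\<close>.
\<close>

definition linearly_isomorphic ::
    "'a::real_vector set \<Rightarrow> 'b::real_vector set \<Rightarrow> bool" where
  "linearly_isomorphic P Q \<longleftrightarrow>
     (\<exists>f g. linear f \<and> linear g \<and> f ` P = Q \<and> g ` Q = P \<and>
            (\<forall>x\<in>P. g (f x) = x) \<and> (\<forall>y\<in>Q. f (g y) = y))"

end

theory Submission imports Defs begin

text \<open>
  A nonempty polytope of either kind other than \<open>{0}\<close> lies in a hyperplane on which the sum of all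
  entries is a nonzero constant, so affine isomorphisms extend to linear ones. In a planar
  polytope of size \<open>p \<times> 2 \<times> 2\<close> the layer \<open>i\<close> is determined by its entry \<open>(1, 1)\<close>, which
  ranges over an interval; subtracting the lower ends of these intervals gives a
  classical polytope. If every interval is a point, the result is \<open>{0}\<close> although the planar
  polytope can be a nonzero point, which therefore has to be treated apart.

  This reduction is not injective. However, an isomorphic classical polytope can be rescaled to any
  positive total mass, and there are only continuum many planar polytopes, so the mass can be used
  to encode the polytope one started from. In the other direction, placing the two columns of
  a classical array on the diagonals of the layers is injective. A Schroeder-Bernstein argument
  combines the two injections.
\<close>

section \<open>Set-theoretic tools: a relational Schroeder-Bernstein theorem and real labels for
  closed sets\<close>

text \<open>The usual bijection uses only pairs \<open>(x, f x)\<close> and \<open>(g y, y)\<close>,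
  so a relation that holds for both kinds of pairs holds along its graph.\<close>

lemma Schroeder_Bernstein_rel:
  fixes f :: "'a \<Rightarrow> 'b" and g :: "'b \<Rightarrow> 'a"
  assumes f: "inj_on f A" "f ` A \<subseteq> B" "\<And>x. x \<in> A \<Longrightarrow> R x (f x)"
    and g: "inj_on g B" "g ` B \<subseteq> A" "\<And>y. y \<in> B \<Longrightarrow> R (g y) y"
  shows "\<exists>h. bij_betw h A B \<and> (\<forall>x\<in>A. R x (h x))"
proof -
  define X where "X = lfp (\<lambda>X. A - g ` (B - f ` X))"
  have X: "X = A - g ` (B - f ` X)"
    unfolding X_def by (rule lfp_unfold) (blast intro: monoI)
  have XA: "X \<subseteq> A" using X by auto
  have compl: "A - X = g ` (B - f ` X)" using X g(2) by blast
  define k where "k = the_inv_into (B - f ` X) g"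
  have ig: "inj_on g (B - f ` X)" by (rule inj_on_subset[OF g(1)]) auto
  have "bij_betw g (B - f ` X) (A - X)" using ig compl by (simp add: bij_betw_def)
  then have k: "bij_betw k (A - X) (B - f ` X)" unfolding k_def by (rule bij_betw_the_inv_into)
  have gk: "g (k x) = x" if "x \<in> A - X" for x
    unfolding k_def by (rule f_the_inv_into_f[OF ig]) (use that compl in auto)
  define h where "h x = (if x \<in> X then f x else k x)" for x
  have "bij_betw f X (f ` X)" using inj_on_subset[OF f(1) XA] by (simp add: bij_betw_def)
  then have hX: "bij_betw h X (f ` X)"
    by (subst bij_betw_cong[where g = f]) (auto simp: h_def)
  have hc: "bij_betw h (A - X) (B - f ` X)"
    using k by (subst bij_betw_cong[where g = k]) (auto simp: h_def)
  have "bij_betw h (X \<union> (A - X)) (f ` X \<union> (B - f ` X))"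
    using hX hc by (rule bij_betw_combine) auto
  moreover have "X \<union> (A - X) = A" "f ` X \<union> (B - f ` X) = B" using XA f(2) by auto
  moreover have "R x (h x)" if "x \<in> A" for x
  proof (cases "x \<in> X")
    case False
    then have "k x \<in> B" using bij_betwE[OF k] that by auto
    from g(3)[OF this] show ?thesis using False that gk by (simp add: h_def)
  qed (use that f(3) in \<open>simp add: h_def\<close>)
  ultimately show ?thesis by auto
qed

text \<open>An open set is the union of the basic open sets inside it, so a closed set is coded by
  the basic sets inside its complement. With a countable basis this code is a set of naturals, and
  those inject into the reals.\<close>

lemma closed_sets_inject_reals:
  "\<exists>h :: 'a::second_countable_topology set \<Rightarrow> real. inj_on h (Collect closed)"
proof -
  obtain \<B> :: "'a set set" where \<B>: "countable \<B>" "topological_basis \<B>"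
    using ex_countable_basis by blast
  obtain r :: "nat set \<Rightarrow> real" where r: "inj r"
    using nat_sets_eqpoll_reals unfolding eqpoll_def bij_betw_def by blast
  define n where "n C = to_nat_on \<B> ` {B \<in> \<B>. B \<subseteq> - C}" for C :: "'a set"
  have "inj_on n (Collect closed)"
  proof (rule inj_onI)
    fix C D :: "'a set"
    assume "C \<in> Collect closed" "D \<in> Collect closed" and eq: "n C = n D"
    then have op: "open (- C)" "open (- D)" by (simp_all add: open_Compl)
    have "inj_on (to_nat_on \<B>) \<B>" using \<B>(1) by (rule inj_on_to_nat_on)
    then have "{B \<in> \<B>. B \<subseteq> - C} = {B \<in> \<B>. B \<subseteq> - D}"
      using eq unfolding n_def by (subst (asm) inj_on_image_eq_iff) auto
    moreover have "\<Union>{B \<in> \<B>. B \<subseteq> S} = S" if "open S" for S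
      using topological_basisE[OF \<B>(2) that] by blast
    ultimately have "- C = - D" using op by metis
    then show "C = D" by auto
  qed
  then have "inj_on (r \<circ> n) (Collect closed)"
    using r by (meson comp_inj_on inj_on_subset subset_UNIV)
  then show ?thesis by blast
qed

section \<open>Linear isomorphism of sets\<close>

lemma linearly_isomorphic_sym: "linearly_isomorphic P Q \<Longrightarrow> linearly_isomorphic Q P"
  unfolding linearly_isomorphic_def by metis

lemma linearly_isomorphic_trans:
  assumes "linearly_isomorphic P Q" "linearly_isomorphic Q R"
  shows "linearly_isomorphic P R"
proof -
  obtain f g where 1: "linear f" "linear g" "f ` P = Q" "g ` Q = P"
    "\<forall>x\<in>P. g (f x) = x" "\<forall>y\<in>Q. f (g y) = y"
    using assms(1) unfolding linearly_isomorphic_def by blast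
  obtain h k where 2: "linear h" "linear k" "h ` Q = R" "k ` R = Q"
    "\<forall>x\<in>Q. k (h x) = x" "\<forall>y\<in>R. h (k y) = y"
    using assms(2) unfolding linearly_isomorphic_def by blast
  have "linear (h \<circ> f)" "linear (g \<circ> k)" using 1 2 by (auto intro: linear_compose)
  moreover have "(h \<circ> f) ` P = R" "(g \<circ> k) ` R = P"
    using 1(3,4) 2(3,4) by (simp_all flip: image_image add: image_comp[symmetric])
  moreover have "\<forall>x\<in>P. (g \<circ> k) ((h \<circ> f) x) = x" "\<forall>y\<in>R. (h \<circ> f) ((g \<circ> k) y) = y"
    using 1 2 by auto
  ultimately show ?thesis unfolding linearly_isomorphic_def by blast
qed

lemma linearly_isomorphic_image:
  assumes "linear f" "linear g" "\<And>x. x \<in> P \<Longrightarrow> g (f x) = x"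
  shows "linearly_isomorphic P (f ` P)"
  unfolding linearly_isomorphic_def
  using assms by (intro exI[of _ f] exI[of _ g]) (auto simp: image_image)

lemma linearly_isomorphic_scaleR:
  assumes "c \<noteq> 0" shows "linearly_isomorphic P ((*\<^sub>R) c ` P)"
  by (rule linearly_isomorphic_image[where g = "(*\<^sub>R) (inverse c)"])
    (use assms in \<open>auto intro: linear_scale_self\<close>)

lemma linearly_isomorphic_empty_iff:
  "linearly_isomorphic P Q \<Longrightarrow> P = {} \<longleftrightarrow> Q = {}"
  unfolding linearly_isomorphic_def by blast

text \<open>Linear maps fix 0, so no other singleton is isomorphic to \<open>{0}\<close>.\<close>

lemma linearly_isomorphic_zero_iff:
  assumes "linearly_isomorphic P Q" shows "P = {0} \<longleftrightarrow> Q = {0}"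
proof -
  obtain f g where "linear f" "linear g" "f ` P = Q" "g ` Q = P"
    using assms unfolding linearly_isomorphic_def by blast
  then show ?thesis using linear_0[of f] linear_0[of g] by force
qed

text \<open>On \<open>P\<close> the constant \<open>a\<close> agrees with the linear map \<open>x \<mapsto> (\<phi> x / c) a\<close>, and similarly on \<open>Q\<close>.\<close>

lemma linearly_isomorphic_affine:
  fixes A :: "'a::real_vector \<Rightarrow> 'b::real_vector" and B :: "'b \<Rightarrow> 'a"
    and \<phi> :: "'a \<Rightarrow> real" and \<psi> :: "'b \<Rightarrow> real"
  assumes lin: "linear A" "linear B" "linear \<phi>" "linear \<psi>"
    and c: "c \<noteq> 0" "\<And>x. x \<in> P \<Longrightarrow> \<phi> x = c"
    and d: "d \<noteq> 0" "\<And>y. y \<in> Q \<Longrightarrow> \<psi> y = d"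
    and P: "\<And>x. x \<in> P \<Longrightarrow> A x + a \<in> Q \<and> B (A x + a) + b = x"
    and Q: "\<And>y. y \<in> Q \<Longrightarrow> B y + b \<in> P \<and> A (B y + b) + a = y"
  shows "linearly_isomorphic P Q"
proof -
  define f where "f x = A x + (\<phi> x / c) *\<^sub>R a" for x
  define g where "g y = B y + (\<psi> y / d) *\<^sub>R b" for y
  have lf: "linear f" unfolding f_def
    by (rule linearI)
      (simp_all add: lin linear_add linear_cmul add_divide_distrib scaleR_left_distrib scaleR_right_distrib)
  have lg: "linear g" unfolding g_def
    by (rule linearI)
      (simp_all add: lin linear_add linear_cmul add_divide_distrib scaleR_left_distrib scaleR_right_distrib)
  have f: "f x = A x + a" if "x \<in> P" for x using that c by (simp add: f_def)
  have g: "g y = B y + b" if "y \<in> Q" for y using that d by (simp add: g_def)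
  have PQ: "f x \<in> Q" "g (f x) = x" if "x \<in> P" for x using P[OF that] f[OF that] g by auto
  have QP: "g y \<in> P" "f (g y) = y" if "y \<in> Q" for y using Q[OF that] g[OF that] f by auto
  have "f ` P = Q" "g ` Q = P" using PQ QP by (metis image_eqI image_subsetI subsetI subset_antisym)+
  with lf lg PQ QP show ?thesis unfolding linearly_isomorphic_def by blast
qed

text \<open>The inner product with \<open>x\<close> is a linear functional whose value at
  \<open>x\<close> is nonzero, so the constant maps between the two points have linear
  extensions.\<close>

lemma linearly_isomorphic_singletons:
  fixes x :: "'a::real_inner" and y :: "'b::real_inner"
  assumes "x \<noteq> 0" "y \<noteq> 0"
  shows "linearly_isomorphic {x} {y}"
  by (rule linearly_isomorphic_affine[where A = "\<lambda>_. 0" and B = "\<lambda>_. 0" and a = y and b = x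
        and \<phi> = "inner x" and \<psi> = "inner y" and c = "inner x x" and d = "inner y y"])
    (use assms in \<open>auto intro: bounded_linear.linear bounded_linear_inner_right bounded_linear_zero\<close>)

section \<open>Elementary properties of the polytopes\<close>

lemma classical_transportation_polytope_2_iff:
  fixes x :: "real ^ 2 ^ 'p"
  shows "x \<in> classical_transportation_polytope u v \<longleftrightarrow>
    (\<forall>i. 0 \<le> x $ i $ 1 \<and> 0 \<le> x $ i $ 2 \<and> x $ i $ 1 + x $ i $ 2 = u $ i) \<and>
    (\<Sum>i\<in>UNIV. x $ i $ 1) = v $ 1 \<and> (\<Sum>i\<in>UNIV. x $ i $ 2) = v $ 2"
  unfolding classical_transportation_polytope_def by (auto simp: forall_2 sum_2)

lemma planar_transportation_polytope_2_2_iff: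
  fixes x :: "real ^ 2 ^ 2 ^ 'p"
  shows "x \<in> planar_transportation_polytope U V W \<longleftrightarrow>
    (\<forall>i. (\<forall>j k. 0 \<le> x $ i $ j $ k) \<and>
      x $ i $ 1 $ 1 + x $ i $ 2 $ 1 = V $ i $ 1 \<and> x $ i $ 1 $ 2 + x $ i $ 2 $ 2 = V $ i $ 2 \<and>
      x $ i $ 1 $ 1 + x $ i $ 1 $ 2 = W $ i $ 1 \<and> x $ i $ 2 $ 1 + x $ i $ 2 $ 2 = W $ i $ 2) \<and>
    (\<forall>j k. (\<Sum>i\<in>UNIV. x $ i $ j $ k) = U $ j $ k)"
  unfolding planar_transportation_polytope_def by (auto simp: forall_2 sum_2)

lemma closed_planar_transportation_polytope: "closed (planar_transportation_polytope U V W)"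
  unfolding planar_transportation_polytope_def
  by (intro closed_Collect_conj closed_Collect_all closed_Collect_le closed_Collect_eq
      continuous_intros)

lemma scaleR_classical_transportation_polytope:
  fixes u :: "real ^ 'p" and v :: "real ^ 'q"
  assumes "c > 0"
  shows "(*\<^sub>R) c ` classical_transportation_polytope u v
    = classical_transportation_polytope (c *\<^sub>R u) (c *\<^sub>R v)"
proof -
  \<comment> \<open>The factor and marginals are generalized here, so that the same inclusion
    applied with \<open>inverse c\<close> yields the converse.\<close>
  have sub: "(*\<^sub>R) c ` classical_transportation_polytope u v
      \<subseteq> classical_transportation_polytope (c *\<^sub>R u) (c *\<^sub>R v)" if "c > 0"
    for c :: real and u :: "real ^ 'p" and v :: "real ^ 'q"
    using that by (auto simp: classical_transportation_polytope_def simp flip: sum_distrib_left)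
  have "x \<in> (*\<^sub>R) c ` classical_transportation_polytope u v"
    if "x \<in> classical_transportation_polytope (c *\<^sub>R u) (c *\<^sub>R v)" for x
  proof (rule image_eqI)
    show "x = c *\<^sub>R (inverse c *\<^sub>R x)" using assms by simp
    show "inverse c *\<^sub>R x \<in> classical_transportation_polytope u v"
      using sub[of "inverse c" "c *\<^sub>R u" "c *\<^sub>R v"] assms that by auto
  qed
  then show ?thesis using sub[OF assms] by blast
qed

lemma classical_transportation_polytope_mass:
  assumes "x \<in> classical_transportation_polytope u v"
  shows "(\<Sum>i\<in>UNIV. \<Sum>j\<in>UNIV. x $ i $ j) = (\<Sum>i\<in>UNIV. u $ i)"
  using assms by (simp add: classical_transportation_polytope_def)

lemma empty_in_classical_transportation_polytopes:
  "({} :: (real ^ 'q ^ 'p) set) \<in> classical_transportation_polytopes"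
proof -
  have "classical_transportation_polytope (- 1) 0 = ({} :: (real ^ 'q ^ 'p) set)"
  proof -
    have False if "x \<in> classical_transportation_polytope (- 1) 0" for x :: "real ^ 'q ^ 'p"
    proof -
      \<comment> \<open>Any row gives the contradiction; \<open>undefined\<close> serves as an
        arbitrary index of the nonempty type \<open>'p\<close>.\<close>
      have "0 \<le> (\<Sum>j\<in>UNIV. x $ undefined $ j)"
        by (rule sum_nonneg) (use that in \<open>simp add: classical_transportation_polytope_def\<close>)
      moreover have "(\<Sum>j\<in>UNIV. x $ undefined $ j) = - 1"
        using that by (simp add: classical_transportation_polytope_def)
      ultimately show False by simp
    qed
    then show ?thesis by blast
  qed
  then show ?thesis unfolding classical_transportation_polytopes_def by blast
qed

lemma zero_in_classical_transportation_polytopes: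
  "{0 :: real ^ 'q ^ 'p} \<in> classical_transportation_polytopes"
proof -
  have "x = 0" if "x \<in> classical_transportation_polytope 0 0" for x :: "real ^ 'q ^ 'p"
  proof -
    have nn: "\<forall>i j. 0 \<le> x $ i $ j" and s: "\<forall>i. (\<Sum>j\<in>UNIV. x $ i $ j) = 0"
      using that by (simp_all add: classical_transportation_polytope_def)
    have "x $ i $ j = 0" for i j
      using s[rule_format, of i] nn by (simp add: sum_nonneg_eq_0_iff)
    then show ?thesis by (simp add: vec_eq_iff)
  qed
  moreover have "0 \<in> classical_transportation_polytope 0 (0 :: real ^ 'q)"
    by (simp add: classical_transportation_polytope_def)
  ultimately have "classical_transportation_polytope 0 0 = {0 :: real ^ 'q ^ 'p}" by blast
  then show ?thesis unfolding classical_transportation_polytopes_def by blast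
qed

section \<open>From classical to planar polytopes\<close>

text \<open>Both row sums and both column sums of layer \<open>i\<close> equal
  \<open>y $ i $ 1 + y $ i $ 2\<close>, so the row marginals of \<open>y\<close> become marginals of
  the layers.\<close>

definition diagonal_embedding :: "real ^ 2 ^ 'p \<Rightarrow> real ^ 2 ^ 2 ^ 'p" where
  "diagonal_embedding y = (\<chi> i j k. if j = k then y $ i $ 1 else y $ i $ 2)"

definition first_row :: "real ^ 2 ^ 2 ^ 'p \<Rightarrow> real ^ 2 ^ 'p" where
  "first_row x = (\<chi> i k. x $ i $ 1 $ k)"

lemma first_row_diagonal_embedding: "first_row (diagonal_embedding y) = y"
  by (simp add: first_row_def diagonal_embedding_def vec_eq_iff forall_2)

lemma linear_diagonal_embedding: "linear diagonal_embedding"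
  by (rule linearI) (simp_all add: diagonal_embedding_def vec_eq_iff)

lemma linear_first_row: "linear first_row"
  by (rule linearI) (simp_all add: first_row_def vec_eq_iff)

text \<open>A 2 by 2 layer whose row and column sums all equal \<open>u $ i\<close> has equal
  entries along each diagonal. Hence every point of the planar polytope with these marginals comes
  from the embedding.\<close>

lemma diagonal_embedding_classical_transportation_polytope:
  fixes u :: "real ^ 'p" and v :: "real ^ 2"
  shows "diagonal_embedding ` classical_transportation_polytope u v
    = planar_transportation_polytope (\<chi> j k. if j = k then v $ 1 else v $ 2) (\<chi> i k. u $ i) (\<chi> i j. u $ i)"
    (is "_ = ?P")
proof (intro equalityI subsetI)
  fix x assume "x \<in> diagonal_embedding ` classical_transportation_polytope u v"
  then show "x \<in> ?P"
    by (auto simp: diagonal_embedding_def classical_transportation_polytope_2_iff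
        planar_transportation_polytope_2_2_iff forall_2 add.commute)
next
  fix x assume x: "x \<in> ?P"
  show "x \<in> diagonal_embedding ` classical_transportation_polytope u v"
  proof (rule image_eqI)
    have "x $ i $ 2 $ 1 = x $ i $ 1 $ 2" "x $ i $ 2 $ 2 = x $ i $ 1 $ 1" for i
    proof -
      have "x $ i $ 1 $ 1 + x $ i $ 2 $ 1 = u $ i" "x $ i $ 1 $ 1 + x $ i $ 1 $ 2 = u $ i"
        "x $ i $ 2 $ 1 + x $ i $ 2 $ 2 = u $ i"
        using x by (simp_all add: planar_transportation_polytope_2_2_iff)
      then show "x $ i $ 2 $ 1 = x $ i $ 1 $ 2" "x $ i $ 2 $ 2 = x $ i $ 1 $ 1" by linarith+
    qed
    then show "x = diagonal_embedding (first_row x)"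
      by (simp add: first_row_def diagonal_embedding_def vec_eq_iff forall_2)
    show "first_row x \<in> classical_transportation_polytope u v"
      using x by (auto simp: first_row_def classical_transportation_polytope_2_iff
          planar_transportation_polytope_2_2_iff)
  qed
qed

section \<open>From planar to classical polytopes\<close>

text \<open>If layer \<open>i\<close> has (1,1) entry \<open>t\<close> in
  \<open>[lo i, hi i]\<close>, row \<open>i\<close> of the classical array is
  \<open>(t - lo i, hi i - t)\<close>. The total mass is then the sum of the interval lengths, which
  is positive unless all intervals are points. Positivity permits rescaling to any positive
  mass.\<close>

lemma linearly_isomorphic_classical_if_nonzero:
  fixes x\<^sub>0 :: "real ^ 2 ^ 2 ^ 'p"
  assumes x\<^sub>0: "x\<^sub>0 \<in> planar_transportation_polytope U V W" "x\<^sub>0 \<noteq> 0"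
  shows "\<exists>(u :: real ^ 'p) (v :: real ^ 2). linearly_isomorphic (planar_transportation_polytope U V W)
    (classical_transportation_polytope u v) \<and> 0 < (\<Sum>i\<in>UNIV. u $ i)"
proof -
  let ?P = "planar_transportation_polytope U V W"
  \<comment> \<open>The lower bound expresses nonnegativity of the entries (1,1) and (2,2), the
    upper bound that of (1,2) and (2,1).\<close>
  define lo where "lo i = max 0 (V $ i $ 1 - W $ i $ 2)" for i
  define hi where "hi i = min (W $ i $ 1) (V $ i $ 1)" for i
  have range: "lo i \<le> x $ i $ 1 $ 1" "x $ i $ 1 $ 1 \<le> hi i"
    and entries: "x $ i $ 1 $ 2 = W $ i $ 1 - x $ i $ 1 $ 1" "x $ i $ 2 $ 1 = V $ i $ 1 - x $ i $ 1 $ 1"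
      "x $ i $ 2 $ 2 = W $ i $ 2 - V $ i $ 1 + x $ i $ 1 $ 1" if "x \<in> ?P" for x i
  proof -
    have *: "\<forall>j k. 0 \<le> x $ i $ j $ k" "x $ i $ 1 $ 1 + x $ i $ 2 $ 1 = V $ i $ 1"
      "x $ i $ 1 $ 1 + x $ i $ 1 $ 2 = W $ i $ 1" "x $ i $ 2 $ 1 + x $ i $ 2 $ 2 = W $ i $ 2"
      using that by (simp_all add: planar_transportation_polytope_2_2_iff)
    then have "0 \<le> x $ i $ 1 $ 1" "0 \<le> x $ i $ 1 $ 2" "0 \<le> x $ i $ 2 $ 1" "0 \<le> x $ i $ 2 $ 2"
      by blast+
    with *(2-4) show "lo i \<le> x $ i $ 1 $ 1" "x $ i $ 1 $ 1 \<le> hi i"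
      "x $ i $ 1 $ 2 = W $ i $ 1 - x $ i $ 1 $ 1" "x $ i $ 2 $ 1 = V $ i $ 1 - x $ i $ 1 $ 1"
      "x $ i $ 2 $ 2 = W $ i $ 2 - V $ i $ 1 + x $ i $ 1 $ 1"
      unfolding lo_def hi_def by linarith+
  qed
  have lohi: "lo i \<le> hi i" for i using range[OF x\<^sub>0(1), of i] by linarith
  show ?thesis
  proof (cases "\<forall>i. lo i = hi i")
    case True
    have "x = x\<^sub>0" if "x \<in> ?P" for x
    proof -
      have "x $ i $ 1 $ 1 = x\<^sub>0 $ i $ 1 $ 1" for i
        using range[OF that, of i] range[OF x\<^sub>0(1), of i] True by (metis order_antisym order_trans)
      then show ?thesis using entries[OF that] entries[OF x\<^sub>0(1)]
        by (simp add: vec_eq_iff forall_2)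
    qed
    then have P: "?P = {x\<^sub>0}" using x\<^sub>0(1) by blast
    \<comment> \<open>Any classical polytope that is a nonzero point will do. Here the second column
      has sum 0 and so vanishes, which forces the first column to be all ones.\<close>
    define y :: "real ^ 2 ^ 'p" where "y = (\<chi> i j. if j = 1 then 1 else 0)"
    define u :: "real ^ 'p" where "u = 1"
    define v :: "real ^ 2" where "v = (\<chi> j. if j = 1 then real CARD('p) else 0)"
    have "z = y" if "z \<in> classical_transportation_polytope u v" for z
    proof -
      have z: "\<forall>i. 0 \<le> z $ i $ 2 \<and> z $ i $ 1 + z $ i $ 2 = 1" "(\<Sum>i\<in>UNIV. z $ i $ 2) = 0"
        using that by (simp_all add: classical_transportation_polytope_2_iff u_def v_def)
      then have "\<forall>i. z $ i $ 2 = 0" by (simp add: sum_nonneg_eq_0_iff)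
      with z(1) show ?thesis by (simp add: y_def vec_eq_iff forall_2)
    qed
    moreover have "y \<in> classical_transportation_polytope u v"
      by (simp add: classical_transportation_polytope_2_iff u_def v_def y_def)
    ultimately have "classical_transportation_polytope u v = {y}" by blast
    moreover have "y \<noteq> 0" by (auto simp: y_def vec_eq_iff forall_2)
    ultimately have "linearly_isomorphic ?P (classical_transportation_polytope u v)"
      using P x\<^sub>0(2) by (simp add: linearly_isomorphic_singletons)
    moreover have "0 < (\<Sum>i\<in>UNIV. u $ i)" by (simp add: u_def)
    ultimately show ?thesis by blast
  next
    case False
    define u :: "real ^ 'p" where "u = (\<chi> i. hi i - lo i)"
    \<comment> \<open>The first column of the classical array is the (1,1) line of the planar one
      shifted by \<open>lo\<close>, and so is its sum.\<close>
    define s where "s = U $ 1 $ 1 - (\<Sum>i\<in>UNIV. lo i)"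
    define v :: "real ^ 2" where "v = (\<chi> j. if j = 1 then s else (\<Sum>i\<in>UNIV. u $ i) - s)"
    let ?Q = "classical_transportation_polytope u v"
    have mass_u: "0 < (\<Sum>i\<in>UNIV. u $ i)"
    proof -
      obtain i where "lo i \<noteq> hi i" using False by blast
      then have "0 < u $ i" using lohi[of i] by (simp add: u_def)
      then show ?thesis using lohi by (intro sum_pos2[of _ i]) (auto simp: u_def)
    qed
    have U: "(\<Sum>i\<in>UNIV. x $ i $ j $ k) = U $ j $ k" if "x \<in> ?P" for x j k
      using that by (simp add: planar_transportation_polytope_2_2_iff)
    \<comment> \<open>Since the planar polytope is nonempty, its marginals are consistent:
      \<open>W\<close>, the first column of \<open>V\<close> and \<open>U $ 1 $ 1\<close> determine
      the others. A point built from a classical array therefore needs no further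
      conditions.\<close>
    have V2: "V $ i $ 2 = W $ i $ 1 + W $ i $ 2 - V $ i $ 1" for i
    proof -
      have "x\<^sub>0 $ i $ 1 $ 2 + x\<^sub>0 $ i $ 2 $ 2 = V $ i $ 2"
        using x\<^sub>0(1) by (simp add: planar_transportation_polytope_2_2_iff)
      then show ?thesis using entries[OF x\<^sub>0(1), of i] by linarith
    qed
    have U2: "U $ 1 $ 2 = (\<Sum>i\<in>UNIV. W $ i $ 1) - U $ 1 $ 1" "U $ 2 $ 1 = (\<Sum>i\<in>UNIV. V $ i $ 1) - U $ 1 $ 1"
      "U $ 2 $ 2 = (\<Sum>i\<in>UNIV. W $ i $ 2) - (\<Sum>i\<in>UNIV. V $ i $ 1) + U $ 1 $ 1"
      unfolding U[OF x\<^sub>0(1), symmetric]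
      by (simp_all add: entries[OF x\<^sub>0(1)] sum_subtractf sum.distrib)
    \<comment> \<open>\<open>A x + a\<close> forms the rows \<open>(t - lo i, hi i - t)\<close>.
      Conversely \<open>b\<close> is the array with \<open>t = lo i\<close> in every layer, and
      \<open>B\<close> adds \<open>y $ i $ 1\<close> with alternating signs, which leaves the line
      sums within each layer unchanged.\<close>
    define A :: "real ^ 2 ^ 2 ^ 'p \<Rightarrow> real ^ 2 ^ 'p"
      where "A x = (\<chi> i j. if j = 1 then x $ i $ 1 $ 1 else - x $ i $ 1 $ 1)" for x
    define a :: "real ^ 2 ^ 'p" where "a = (\<chi> i j. if j = 1 then - lo i else hi i)"
    define B :: "real ^ 2 ^ 'p \<Rightarrow> real ^ 2 ^ 2 ^ 'p"
      where "B y = (\<chi> i j k. if j = k then y $ i $ 1 else - y $ i $ 1)" for y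
    define b :: "real ^ 2 ^ 2 ^ 'p" where "b = (\<chi> i j k. if j = 1 then
        (if k = 1 then lo i else W $ i $ 1 - lo i) else
        (if k = 1 then V $ i $ 1 - lo i else W $ i $ 2 - V $ i $ 1 + lo i))"
    have "linearly_isomorphic ?P ?Q"
    proof (rule linearly_isomorphic_affine[where A = A and B = B and a = a and b = b
            and c = "\<Sum>i\<in>UNIV. \<Sum>j\<in>UNIV. W $ i $ j" and d = "\<Sum>i\<in>UNIV. u $ i"])
      show "linear A" "linear B"
        by (rule linearI; simp add: A_def B_def vec_eq_iff)+
      show "linear (\<lambda>x :: real ^ 2 ^ 2 ^ 'p. \<Sum>i\<in>UNIV. \<Sum>j\<in>UNIV. \<Sum>k\<in>UNIV. x $ i $ j $ k)"
        "linear (\<lambda>x :: real ^ 2 ^ 'p. \<Sum>i\<in>UNIV. \<Sum>j\<in>UNIV. x $ i $ j)"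
        by (rule linearI; simp add: sum.distrib sum_distrib_left)+
      show "(\<Sum>i\<in>UNIV. u $ i) \<noteq> 0" using mass_u by simp
      show "(\<Sum>i\<in>UNIV. \<Sum>j\<in>UNIV. y $ i $ j) = (\<Sum>i\<in>UNIV. u $ i)" if "y \<in> ?Q" for y
        using that by (rule classical_transportation_polytope_mass)
      show "(\<Sum>i\<in>UNIV. \<Sum>j\<in>UNIV. \<Sum>k\<in>UNIV. x $ i $ j $ k) = (\<Sum>i\<in>UNIV. \<Sum>j\<in>UNIV. W $ i $ j)"
        if "x \<in> ?P" for x
        using that by (simp add: planar_transportation_polytope_def)
      have nn: "0 \<le> x\<^sub>0 $ i $ j $ k" for i j k
        using x\<^sub>0(1) by (simp add: planar_transportation_polytope_def)
      show "(\<Sum>i\<in>UNIV. \<Sum>j\<in>UNIV. W $ i $ j) \<noteq> 0"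
      proof
        \<comment> \<open>The sum of \<open>W\<close> is the total mass of \<open>x\<^sub>0\<close>,
          whose entries are nonnegative, so mass 0 would make \<open>x\<^sub>0\<close> zero.\<close>
        assume "(\<Sum>i\<in>UNIV. \<Sum>j\<in>UNIV. W $ i $ j) = 0"
        then have "(\<Sum>i\<in>UNIV. \<Sum>j\<in>UNIV. \<Sum>k\<in>UNIV. x\<^sub>0 $ i $ j $ k) = 0"
          using x\<^sub>0(1) by (simp add: planar_transportation_polytope_def)
        then have "x\<^sub>0 = 0" using nn by (simp add: vec_eq_iff sum_nonneg_eq_0_iff sum_nonneg)
        with x\<^sub>0(2) show False by simp
      qed
    next
      fix x assume x: "x \<in> ?P"
      have "A x + a \<in> ?Q"
        using range[OF x] U[OF x]
        by (simp add: classical_transportation_polytope_2_iff A_def a_def u_def v_def s_def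
            sum.distrib sum_subtractf sum_negf)
      moreover have "B (A x + a) + b = x"
        by (simp add: A_def B_def a_def b_def vec_eq_iff forall_2 entries[OF x])
      ultimately show "A x + a \<in> ?Q \<and> B (A x + a) + b = x" ..
    next
      fix y assume y: "y \<in> ?Q"
      have y2: "y $ i $ 2 = hi i - lo i - y $ i $ 1" and y_nn: "0 \<le> y $ i $ 1" "0 \<le> y $ i $ 2" for i
        using y by (auto simp: classical_transportation_polytope_2_iff u_def algebra_simps)
      have s: "(\<Sum>i\<in>UNIV. y $ i $ 1) = s"
        using y by (simp add: classical_transportation_polytope_2_iff v_def)
      have bounds: "0 \<le> lo i" "V $ i $ 1 - W $ i $ 2 \<le> lo i" "hi i \<le> W $ i $ 1" "hi i \<le> V $ i $ 1" for i
        by (simp_all add: lo_def hi_def)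
      have "0 \<le> (B y + b) $ i $ j $ k" for i j k
      proof -
        have "0 \<le> y $ i $ 1 + lo i" "0 \<le> - y $ i $ 1 + (W $ i $ 1 - lo i)"
          "0 \<le> - y $ i $ 1 + (V $ i $ 1 - lo i)" "0 \<le> y $ i $ 1 + (W $ i $ 2 - V $ i $ 1 + lo i)"
          using bounds[of i] y2[of i] y_nn[of i] by linarith+
        then have "\<forall>j k. 0 \<le> (B y + b) $ i $ j $ k" by (simp add: B_def b_def forall_2)
        then show ?thesis by blast
      qed
      then have "B y + b \<in> ?P"
        unfolding planar_transportation_polytope_2_2_iff
        by (simp add: forall_2 U2 V2 B_def b_def sum.distrib sum_subtractf sum_negf s s_def)
      moreover have "A (B y + b) + a = y"
        by (simp add: A_def B_def a_def b_def vec_eq_iff forall_2 y2)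
      ultimately show "B y + b \<in> ?P \<and> A (B y + b) + a = y" ..
    qed
    with mass_u show ?thesis by blast
  qed
qed

text \<open>Positive scaling preserves both classical polytopes and isomorphism, so the mass
  \<open>m\<close> is a free parameter. The set \<open>{0}\<close> is excepted because its
  isomorphic copies all have mass 0; a copy of \<open>{}\<close> has no point from which a mass
  could be read.\<close>

lemma linearly_isomorphic_classical_of_mass:
  fixes P :: "(real ^ 2 ^ 2 ^ 'p) set"
  assumes P: "P \<in> planar_transportation_polytopes" and m: "0 < m"
  shows "\<exists>Q \<in> (classical_transportation_polytopes :: (real ^ 2 ^ 'p) set set). linearly_isomorphic P Q \<and>
    (P = {} \<or> P = {0} \<or> (\<forall>y\<in>Q. (\<Sum>i\<in>UNIV. \<Sum>j\<in>UNIV. y $ i $ j) = m))"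
proof -
  consider "P = {}" | "P = {0}" | x where "x \<in> P" "x \<noteq> 0" by blast
  then show ?thesis
  proof cases
    case 1
    have "linearly_isomorphic ({} :: (real ^ 2 ^ 2 ^ 'p) set) ({} :: (real ^ 2 ^ 'p) set)"
      unfolding linearly_isomorphic_def
      by (intro exI[of _ "\<lambda>_. 0"]) (auto intro: module_hom_zero)
    then show ?thesis using 1 empty_in_classical_transportation_polytopes by blast
  next
    case 2
    have "linearly_isomorphic {0 :: real ^ 2 ^ 2 ^ 'p} {0 :: real ^ 2 ^ 'p}"
      unfolding linearly_isomorphic_def
      by (intro exI[of _ "\<lambda>_. 0"]) (auto intro: module_hom_zero)
    then show ?thesis using 2 zero_in_classical_transportation_polytopes by blast
  next
    case 3
    obtain U V W where UVW: "P = planar_transportation_polytope U V W"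
      using P unfolding planar_transportation_polytopes_def by blast
    obtain u :: "real ^ 'p" and v :: "real ^ 2" where
      iso: "linearly_isomorphic P (classical_transportation_polytope u v)"
      and pos: "0 < (\<Sum>i\<in>UNIV. u $ i)"
      using linearly_isomorphic_classical_if_nonzero 3 unfolding UVW by blast
    define c where "c = m / (\<Sum>i\<in>UNIV. u $ i)"
    have c: "c > 0" using m pos by (simp add: c_def)
    let ?Q = "classical_transportation_polytope (c *\<^sub>R u) (c *\<^sub>R v)"
    have "linearly_isomorphic P ?Q"
      using linearly_isomorphic_trans[OF iso linearly_isomorphic_scaleR[of c]] c
      by (simp add: scaleR_classical_transportation_polytope)
    moreover have "(\<Sum>i\<in>UNIV. \<Sum>j\<in>UNIV. y $ i $ j) = m" if "y \<in> ?Q" for y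
      using classical_transportation_polytope_mass[OF that] pos
      by (simp add: c_def flip: sum_distrib_left sum_divide_distrib)
    ultimately show ?thesis unfolding classical_transportation_polytopes_def by blast
  qed
qed

section \<open>The bijection\<close>

lemma planar_classical_bijection:
  "\<exists>\<Phi> :: (real ^ 2 ^ 2 ^ 'p) set \<Rightarrow> (real ^ 2 ^ 'p) set.
     bij_betw \<Phi> planar_transportation_polytopes classical_transportation_polytopes \<and>
     (\<forall>P \<in> planar_transportation_polytopes. linearly_isomorphic P (\<Phi> P))"
proof -
  let ?\<P> = "planar_transportation_polytopes :: (real ^ 2 ^ 2 ^ 'p) set set"
  let ?\<C> = "classical_transportation_polytopes :: (real ^ 2 ^ 'p) set set"
  obtain h :: "(real ^ 2 ^ 2 ^ 'p) set \<Rightarrow> real" where h: "inj_on h (Collect closed)"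
    using closed_sets_inject_reals by blast
  have h_eq: "P = P'" if "P \<in> ?\<P>" "P' \<in> ?\<P>" "h P = h P'" for P P'
    using that inj_onD[OF h] closed_planar_transportation_polytope
    unfolding planar_transportation_polytopes_def by blast
  \<comment> \<open>The exponential turns the injective real label \<open>h P\<close> into a
    positive mass.\<close>
  have "\<forall>P\<in>?\<P>. \<exists>Q. Q \<in> ?\<C> \<and> linearly_isomorphic P Q \<and>
      (P = {} \<or> P = {0} \<or> (\<forall>y\<in>Q. (\<Sum>i\<in>UNIV. \<Sum>j\<in>UNIV. y $ i $ j) = exp (h P)))"
    using linearly_isomorphic_classical_of_mass[OF _ exp_gt_zero] by blast
  then obtain F where F: "\<forall>P\<in>?\<P>. F P \<in> ?\<C> \<and> linearly_isomorphic P (F P) \<and>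
      (P = {} \<or> P = {0} \<or> (\<forall>y\<in>F P. (\<Sum>i\<in>UNIV. \<Sum>j\<in>UNIV. y $ i $ j) = exp (h P)))"
    by (rule bchoice[THEN exE])
  have inj: "inj_on F ?\<P>"
  proof (rule inj_onI)
    fix P P' assume P: "P \<in> ?\<P>" "P' \<in> ?\<P>" "F P = F P'"
    have iso: "linearly_isomorphic P (F P)" "linearly_isomorphic P' (F P)" using F P by auto
    \<comment> \<open>The two exceptional polytopes, which carry no label, are recognized from their
      isomorphism types. For all others a point of \<open>F P\<close> reveals the label.\<close>
    have "P = {} \<longleftrightarrow> P' = {}" "P = {0} \<longleftrightarrow> P' = {0}"
      using linearly_isomorphic_empty_iff[OF iso(1)] linearly_isomorphic_empty_iff[OF iso(2)]
        linearly_isomorphic_zero_iff[OF iso(1)] linearly_isomorphic_zero_iff[OF iso(2)] by blast+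
    moreover have "P = P'" if ne: "P \<noteq> {}" "P \<noteq> {0}" "P' \<noteq> {}" "P' \<noteq> {0}"
    proof -
      obtain y where "y \<in> F P" using linearly_isomorphic_empty_iff[OF iso(1)] ne(1) by blast
      then have "exp (h P) = exp (h P')" using F P ne by metis
      then show ?thesis using h_eq P by simp
    qed
    ultimately show "P = P'" by metis
  qed
  show ?thesis
  proof (rule Schroeder_Bernstein_rel[OF inj])
    show "inj_on ((`) diagonal_embedding) ?\<C>"
      by (metis inj_image_eq_iff inj_onI inj_on_inverseI first_row_diagonal_embedding)
    show "(`) diagonal_embedding ` ?\<C> \<subseteq> ?\<P>"
      unfolding classical_transportation_polytopes_def planar_transportation_polytopes_def
      using diagonal_embedding_classical_transportation_polytope by blast
    show "linearly_isomorphic (diagonal_embedding ` Q) Q" for Q :: "(real ^ 2 ^ 'p) set"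
      using linearly_isomorphic_image[OF linear_diagonal_embedding linear_first_row
          first_row_diagonal_embedding] by (rule linearly_isomorphic_sym)
  qed (use F in blast)+
qed

theorem theorem3p2:
  shows "(\<exists>\<Phi> :: (real ^ 2 ^ 2 ^ 'p) set \<Rightarrow> (real ^ 2 ^ 'p) set.
            bij_betw \<Phi> planar_transportation_polytopes classical_transportation_polytopes \<and>
            (\<forall>P \<in> planar_transportation_polytopes. linearly_isomorphic P (\<Phi> P)))
       \<and> (\<forall>(U :: real ^ 2 ^ 2) (V :: real ^ 2 ^ 'p) (W :: real ^ 2 ^ 'p).
            \<exists>(u :: real ^ 'p) (v :: real ^ 2).
              linearly_isomorphic (planar_transportation_polytope U V W)
                                  (classical_transportation_polytope u v))
       \<and> (\<forall>(u :: real ^ 'p) (v :: real ^ 2).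
            \<exists>(U :: real ^ 2 ^ 2) (V :: real ^ 2 ^ 'p) (W :: real ^ 2 ^ 'p).
              linearly_isomorphic (classical_transportation_polytope u v)
                                  (planar_transportation_polytope U V W))"
proof -
  \<comment> \<open>Both existence claims follow from the bijection: its values are classical
    polytopes, and every classical polytope is a value.\<close>
  obtain \<Phi> :: "(real ^ 2 ^ 2 ^ 'p) set \<Rightarrow> (real ^ 2 ^ 'p) set"
    where bij: "bij_betw \<Phi> planar_transportation_polytopes classical_transportation_polytopes"
      and iso: "\<forall>P \<in> planar_transportation_polytopes. linearly_isomorphic P (\<Phi> P)"
    using planar_classical_bijection by blast
  have "\<exists>(u :: real ^ 'p) (v :: real ^ 2). linearly_isomorphic
      (planar_transportation_polytope U V W) (classical_transportation_polytope u v)"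
    for U :: "real ^ 2 ^ 2" and V W :: "real ^ 2 ^ 'p"
  proof -
    have P: "planar_transportation_polytope U V W \<in> planar_transportation_polytopes"
      unfolding planar_transportation_polytopes_def by blast
    then have "\<Phi> (planar_transportation_polytope U V W) \<in> classical_transportation_polytopes"
      using bij bij_betwE by blast
    then show ?thesis using iso P unfolding classical_transportation_polytopes_def by force
  qed
  moreover have "\<exists>(U :: real ^ 2 ^ 2) (V :: real ^ 2 ^ 'p) (W :: real ^ 2 ^ 'p). linearly_isomorphic
      (classical_transportation_polytope u v) (planar_transportation_polytope U V W)"
    for u :: "real ^ 'p" and v :: "real ^ 2"
  proof -
    have "classical_transportation_polytope u v \<in> classical_transportation_polytopes"
      unfolding classical_transportation_polytopes_def by blast
    then obtain P where P: "P \<in> planar_transportation_polytopes"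
      "\<Phi> P = classical_transportation_polytope u v"
      using bij unfolding bij_betw_def by (metis imageE)
    then have "linearly_isomorphic (classical_transportation_polytope u v) P"
      using iso linearly_isomorphic_sym by metis
    then show ?thesis using P(1) unfolding planar_transportation_polytopes_def by blast
  qed
  ultimately show ?thesis using bij iso by blast
qed

end
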